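(* Let $\mathcal{D}=\{S,A,\bar A,B,\bar B\}$ and $\hat{\mathcal{D}}=\{\hat S,\hat A,\hat{\bar A},\hat B,\hat{\bar B}\}$ be two systems, both controlled by a GNN with the same filter taps $\mathcal{H}$, consisting of $L$ layers of graph filters $\mathsf{H}_\ell(\cdot;\cdot,\mathcal{H}_\ell)$ with $F_\ell$ features and filter order $K_\ell$ at layer $\ell$, and with pointwise nonlinearity $\sigma:\mathbb{R}\to\mathbb{R}$ satisfying $|\sigma(a)-\sigma(b)|\le|a-b|$ for all $a,b\in\mathbb{R}$ and $\sigma(0)=0$. Let $C_\Phi=\prod_{\ell=1}^LC_{\mathsf{H}_\ell}$, where $C_{\mathsf{H}_\ell}$ is the size of the $\ell$-th filter, and let $$\xi=\|A\|_2\|\bar A\|_\infty+C_\Phi\|B\|_2\|\bar B\|_\infty,\qquad \hat\xi=\|\hat A\|_2\|\hat{\bar A}\|_\infty+C_\Phi\|\hat B\|_2\|\hat{\bar B}\|_\infty$$ be the stability constants of $\mathcal{D}$ and $\hat{\mathcal{D}}$. Then $$|\xi-\hat\xi|\le\hat C_\xi\,d(\mathcal{D},\hat{\mathcal{D}}),\qquad \hat C_\xi=\|A\|_2+\|\hat{\bar A}\|_\infty+C_\Phi\big(\|B\|_2+\|\hat{\bar B}\|_\infty\big).$$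
   Context: For matrices, $\|\cdot\|_2$ is the spectral norm and $\|\cdot\|_\infty$ is the maximum absolute row sum. Systems. $S,\hat S,A,\hat A,B,\hat B\in\mathbb{R}^{N\times N}$, $\bar A,\hat{\bar A}\in\mathbb{R}^{F\times F}$, $\bar B,\hat{\bar B}\in\mathbb{R}^{G\times F}$. $S$ and $\hat S$ are graph support matrices. The system $\mathcal{D}$ has dynamics $X(t+1)=A\,X(t)\,\bar A+B\,U(t)\,\bar B$ with $X(t)\in\mathbb{R}^{N\times F}$, $U(t)\in\mathbb{R}^{N\times G}$, $U(t)=\Phi(X(t);S,\mathcal{H})$; similarly for $\hat{\mathcal{D}}$ with all matrices replaced by their hatted versions. Distance. $d(\mathcal{D},\hat{\mathcal{D}})$ is the smallest number $\varepsilon$ such that $\|S-\hat S\|_2\le\varepsilon$, $\|A-\hat A\|_2\le\varepsilon$, $\|\bar A-\hat{\bar A}\|_\infty\le\varepsilon$, $\|B-\hat B\|_2\le\varepsilon$, $\|\bar B-\hat{\bar B}\|_\infty\le\varepsilon$ (i.e. the maximum of these five norms). Graph filter. For taps $\{H_k\in\mathbb{R}^{F\times G}\}_{k=0}^K$, $\mathsf{H}(X;S,\mathcal{H})=\sum_{k=0}^KS^kXH_k$. Its frequency responses are $h_{fg}(\lambda)=\sum_{k=0}^K[H_k]_{fg}\lambda^k$ on a fixed interval $[\lambda_l,\lambda_h]$ (the same interval for both systems). The size of the filter is $C_{\mathsf{H}}=\|C\|_\infty$, where $[C]_{fg}=\max_{\lambda\in[\lambda_l,\lambda_h]}|h_{fg}(\lambda)|$.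 GNN. $X_0=X$, $X_\ell=\sigma(\mathsf{H}_\ell(X_{\ell-1};S,\mathcal{H}_\ell))$ for $\ell=1,\dots,L$, $\Phi(X;S,\mathcal{H})=X_L$, with $\sigma$ applied entrywise, $\mathcal{H}_\ell=\{H_{\ell k}\in\mathbb{R}^{F_{\ell-1}\times F_\ell}\}_{k=0}^{K_\ell}$, $\mathcal{H}=\bigcup_\ell\mathcal{H}_\ell$, $F_0=F$, $F_L=G$. *)

theory Defs
  imports "HOL-Analysis.L2_Norm" "Jordan_Normal_Form.Matrix"
begin

(* The layer widths vary with a natural number, so all matrices are carrier-based. *)

definition l2_norm_vec :: "real vec \<Rightarrow> real" where
  "l2_norm_vec v = L2_set (\<lambda>i. v $ i) {..<dim_vec v}"

definition spectral_norm :: "real mat \<Rightarrow> real" where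
  "spectral_norm M =
     (SUP v\<in>{v \<in> carrier_vec (dim_col M). l2_norm_vec v \<le> 1}. l2_norm_vec (M *\<^sub>v v))"

(* The inserted 0 only matters for a matrix without rows. *)
definition row_sum_norm :: "real mat \<Rightarrow> real" where
  "row_sum_norm M = Max (insert 0 ((\<lambda>i. \<Sum>j<dim_col M. \<bar>M $$ (i, j)\<bar>) ` {..<dim_row M}))"

(* E is the edge set, on the nodes 0, ..., N-1; an edge (j, i) carries information from j to i.
   The graph may be directed, weighted and have self-loops. *)
definition graph_support :: "nat \<Rightarrow> (nat \<times> nat) set \<Rightarrow> real mat \<Rightarrow> bool" where
  "graph_support N E S \<longleftrightarrow>
     E \<subseteq> {..<N} \<times> {..<N} \<and> S \<in> carrier_mat N N \<and>
     (\<forall>i<N. \<forall>j<N. i \<noteq> j \<longrightarrow> (j, i) \<notin> E \<longrightarrow> S $$ (i, j) = 0)"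

record lin_system =
  sysS :: "real mat"
  sysA :: "real mat"
  sysAbar :: "real mat"
  sysB :: "real mat"
  sysBbar :: "real mat"

definition graph_system :: "nat \<Rightarrow> nat \<Rightarrow> nat \<Rightarrow> (nat \<times> nat) set \<Rightarrow> lin_system \<Rightarrow> bool" where
  "graph_system N F G E D \<longleftrightarrow>
     graph_support N E (sysS D) \<and>
     sysA D \<in> carrier_mat N N \<and> sysAbar D \<in> carrier_mat F F \<and>
     sysB D \<in> carrier_mat N N \<and> sysBbar D \<in> carrier_mat G F"

definition system_dist :: "lin_system \<Rightarrow> lin_system \<Rightarrow> real" where
  "system_dist D D' = (LEAST \<epsilon>.
     spectral_norm (sysS D - sysS D') \<le> \<epsilon> \<and>
     spectral_norm (sysA D - sysA D') \<le> \<epsilon> \<and>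
     row_sum_norm (sysAbar D - sysAbar D') \<le> \<epsilon> \<and>
     spectral_norm (sysB D - sysB D') \<le> \<epsilon> \<and>
     row_sum_norm (sysBbar D - sysBbar D') \<le> \<epsilon>)"

(* A filter of order K has the taps H 0, ..., H K, all of the same dimensions. *)

definition graph_filter :: "nat \<Rightarrow> (nat \<Rightarrow> real mat) \<Rightarrow> real mat \<Rightarrow> real mat \<Rightarrow> real mat" where
  "graph_filter K H S X =
     mat (dim_row X) (dim_col (H 0)) (\<lambda>ij. \<Sum>k\<le>K. (S ^\<^sub>m k * X * H k) $$ ij)"

definition freq_response :: "nat \<Rightarrow> (nat \<Rightarrow> real mat) \<Rightarrow> nat \<Rightarrow> nat \<Rightarrow> real \<Rightarrow> real" where
  "freq_response K H f g x = (\<Sum>k\<le>K. H k $$ (f, g) * x ^ k)"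

(* The supremum is a maximum: the frequency response is a polynomial and {lo..hi} is compact. *)
definition filter_size :: "real \<Rightarrow> real \<Rightarrow> nat \<Rightarrow> (nat \<Rightarrow> real mat) \<Rightarrow> real" where
  "filter_size lo hi K H =
     row_sum_norm (mat (dim_row (H 0)) (dim_col (H 0))
       (\<lambda>(f, g). SUP x\<in>{lo..hi}. \<bar>freq_response K H f g x\<bar>))"

(* Layers are numbered from 1: K l and H l are the order and the taps of the filter of layer l,
   and gnn \<sigma> K H L S X is the output X_L. *)

fun gnn :: "(real \<Rightarrow> real) \<Rightarrow> (nat \<Rightarrow> nat) \<Rightarrow> (nat \<Rightarrow> nat \<Rightarrow> real mat) \<Rightarrow>
    nat \<Rightarrow> real mat \<Rightarrow> real mat \<Rightarrow> real mat" where
  "gnn \<sigma> K H 0 S X = X"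
| "gnn \<sigma> K H (Suc l) S X =
     map_mat \<sigma> (graph_filter (K (Suc l)) (H (Suc l)) S (gnn \<sigma> K H l S X))"

definition gnn_taps :: "(nat \<Rightarrow> nat) \<Rightarrow> (nat \<Rightarrow> nat) \<Rightarrow> nat \<Rightarrow> (nat \<Rightarrow> nat \<Rightarrow> real mat) \<Rightarrow> bool" where
  "gnn_taps feat K L H \<longleftrightarrow>
     (\<forall>l\<in>{1..L}. \<forall>k\<le>K l. H l k \<in> carrier_mat (feat (l - 1)) (feat l))"

definition gnn_size :: "real \<Rightarrow> real \<Rightarrow> (nat \<Rightarrow> nat) \<Rightarrow> nat \<Rightarrow> (nat \<Rightarrow> nat \<Rightarrow> real mat) \<Rightarrow> real" where
  "gnn_size lo hi K L H = (\<Prod>l=1..L. filter_size lo hi (K l) (H l))"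

(* X is the state trajectory and U the input of D under the feedback \<Phi>, which takes the
   support matrix and the state. *)
definition closed_loop :: "nat \<Rightarrow> nat \<Rightarrow> nat \<Rightarrow> (real mat \<Rightarrow> real mat \<Rightarrow> real mat) \<Rightarrow>
    lin_system \<Rightarrow> (nat \<Rightarrow> real mat) \<Rightarrow> (nat \<Rightarrow> real mat) \<Rightarrow> bool" where
  "closed_loop N F G \<Phi> D X U \<longleftrightarrow>
     (\<forall>t. X t \<in> carrier_mat N F \<and> U t \<in> carrier_mat N G \<and>
          U t = \<Phi> (sysS D) (X t) \<and>
          X (Suc t) = sysA D * X t * sysAbar D + sysB D * U t * sysBbar D)"

definition stability_const :: "real \<Rightarrow> lin_system \<Rightarrow> real" where
  "stability_const c D =
     spectral_norm (sysA D) * row_sum_norm (sysAbar D)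
     + c * spectral_norm (sysB D) * row_sum_norm (sysBbar D)"

lemma gnn_carrier:
  assumes "gnn_taps feat K L H" "X \<in> carrier_mat N (feat 0)" "l \<le> L"
  shows "gnn \<sigma> K H l S X \<in> carrier_mat N (feat l)"
  using assms(3)
proof (induction l)
  case 0
  then show ?case using assms(2) by simp
next
  case (Suc l)
  then have "gnn \<sigma> K H l S X \<in> carrier_mat N (feat l)" by simp
  moreover have "H (Suc l) 0 \<in> carrier_mat (feat l) (feat (Suc l))"
    using assms(1)[unfolded gnn_taps_def, rule_format, of "Suc l" 0] Suc.prems by simp
  ultimately show ?case by (auto simp: graph_filter_def)
qed

(* Every initial state starts a closed-loop trajectory, so assuming one is no restriction. *)
lemma closed_loop_exists:
  assumes "graph_system N F G E D" "gnn_taps feat K L H" "feat 0 = F" "feat L = G"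
    and X0: "X0 \<in> carrier_mat N F"
  shows "\<exists>X U. X 0 = X0 \<and> closed_loop N F G (gnn \<sigma> K H L) D X U"
proof -
  let ?u = "gnn \<sigma> K H L (sysS D)"
  let ?step = "\<lambda>x. sysA D * x * sysAbar D + sysB D * ?u x * sysBbar D"
  define X where "X = (\<lambda>t. (?step ^^ t) X0)"
  have u: "?u x \<in> carrier_mat N G" if "x \<in> carrier_mat N F" for x
    using gnn_carrier[OF assms(2), of x N L] that assms(3,4) by simp
  have X: "X t \<in> carrier_mat N F" for t
  proof (induction t)
    case 0
    then show ?case using X0 by (simp add: X_def)
  next
    case (Suc t)
    have "X (Suc t) = ?step (X t)" by (simp add: X_def)
    also have "\<dots> \<in> carrier_mat N F"
      using u[OF Suc] Suc assms(1) unfolding graph_system_def by auto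
    finally show ?case .
  qed
  have "closed_loop N F G (gnn \<sigma> K H L) D X (\<lambda>t. ?u (X t))"
    unfolding closed_loop_def using X u[OF X] by (simp add: X_def)
  moreover have "X 0 = X0" by (simp add: X_def)
  ultimately show ?thesis by blast
qed

end

theory Submission
  imports Defs
begin

text \<open>The stability constant is a sum of two products of norms, the second weighted by C_Phi,
  which depends only on the taps and the interval and is therefore common to both systems. By the
  reverse triangle inequality (\<open>abs_spectral_norm_diff_le\<close>,
  \<open>abs_row_sum_norm_diff_le\<close>), each norm changes by at most the norm of the matrix
  difference, hence by at most \<open>system_dist D D'\<close>. The splitting a b - a' b' = a (b -
  b') + (a - a') b' in \<open>abs_mult_diff_le\<close> then bounds the change of each product by (a
  + b') times the distance. This is why the final constant mixes left factors of \<open>D\<close>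
  with right factors of \<open>D'\<close>. The two bounds are added with weights 1 and C_Phi \<ge>
  0.\<close>

lemma row_sum_le_row_sum_norm:
  assumes "i < dim_row M"
  shows "(\<Sum>j<dim_col M. \<bar>M $$ (i, j)\<bar>) \<le> row_sum_norm M"
  unfolding row_sum_norm_def using assms by (intro Max_ge) auto

lemma row_sum_norm_nonneg: "0 \<le> row_sum_norm M"
  unfolding row_sum_norm_def by (rule Max_ge) auto

text \<open>The premise \<open>0 \<le> c\<close> answers for the 0 inserted into the
  \<open>Max\<close>, which is the value of the norm when there are no rows.\<close>

lemma row_sum_norm_le:
  assumes "0 \<le> c" and "\<And>i. i < dim_row M \<Longrightarrow> (\<Sum>j<dim_col M. \<bar>M $$ (i, j)\<bar>) \<le> c"
  shows "row_sum_norm M \<le> c"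
  unfolding row_sum_norm_def using assms by (subst Max_le_iff) auto

lemma abs_row_sum_norm_diff_le:
  assumes "M \<in> carrier_mat m n" and "M' \<in> carrier_mat m n"
  shows "\<bar>row_sum_norm M - row_sum_norm M'\<bar> \<le> row_sum_norm (M - M')"
proof -
  \<comment> \<open>Letting \<open>P\<close> and \<open>Q\<close> range over both matrices yields
    the two halves of the absolute value at once; the sign of \<open>M - M'\<close> disappears in
    the entrywise absolute values.\<close>
  have le: "row_sum_norm P \<le> row_sum_norm Q + row_sum_norm (M - M')"
    if P: "P \<in> {M, M'}" and Q: "Q \<in> {M, M'}" for P Q
  proof (rule row_sum_norm_le)
    fix i assume "i < dim_row P"
    then have i: "i < m" using P assms by auto
    have "\<bar>P $$ (i, j)\<bar> \<le> \<bar>Q $$ (i, j)\<bar> + \<bar>(M - M') $$ (i, j)\<bar>" if "j < n" for j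
      using P Q assms i that by auto
    then have "(\<Sum>j<n. \<bar>P $$ (i, j)\<bar>) \<le> (\<Sum>j<n. \<bar>Q $$ (i, j)\<bar>) + (\<Sum>j<n. \<bar>(M - M') $$ (i, j)\<bar>)"
      unfolding sum.distrib[symmetric] by (intro sum_mono) simp
    also have "\<dots> \<le> row_sum_norm Q + row_sum_norm (M - M')"
      using row_sum_le_row_sum_norm[of i Q] row_sum_le_row_sum_norm[of i "M - M'"] Q assms i
      by (intro add_mono) auto
    finally show "(\<Sum>j<dim_col P. \<bar>P $$ (i, j)\<bar>) \<le> row_sum_norm Q + row_sum_norm (M - M')"
      using P assms by auto
  qed (simp add: row_sum_norm_nonneg)
  show ?thesis
    using le[of M M'] le[of M' M] by simp
qed

lemma l2_norm_vec_nonneg: "0 \<le> l2_norm_vec v"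
  by (simp add: l2_norm_vec_def)

lemma abs_vec_index_le_l2_norm:
  assumes "j < dim_vec v"
  shows "\<bar>v $ j\<bar> \<le> l2_norm_vec v"
proof -
  \<comment> \<open>Squaring forgets signs, so \<open>member_le_L2_set\<close> can be applied to the
    absolute values of the entries.\<close>
  have "L2_set (\<lambda>i. \<bar>v $ i\<bar>) {..<dim_vec v} = l2_norm_vec v"
    by (simp add: l2_norm_vec_def L2_set_def)
  moreover have "\<bar>v $ j\<bar> \<le> L2_set (\<lambda>i. \<bar>v $ i\<bar>) {..<dim_vec v}"
    using assms by (intro member_le_L2_set) auto
  ultimately show ?thesis by simp
qed

text \<open>A real supremum can be compared with its members only once boundedness is known. Vectors
  in the unit ball have entries of absolute value at most 1, so the sum of the absolute values of
  all entries of \<open>M\<close> is a crude but sufficient bound.\<close>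

lemma bdd_above_spectral_norm:
  "bdd_above ((\<lambda>v. l2_norm_vec (M *\<^sub>v v)) `
     {v \<in> carrier_vec (dim_col M). l2_norm_vec v \<le> 1})"
proof (rule bdd_aboveI2)
  fix v assume v: "v \<in> {v \<in> carrier_vec (dim_col M). l2_norm_vec v \<le> 1}"
  have v1: "\<bar>v $ j\<bar> \<le> 1" if "j < dim_col M" for j
    using abs_vec_index_le_l2_norm[of j v] v that by auto
  have "l2_norm_vec (M *\<^sub>v v) \<le> (\<Sum>i<dim_row M. \<bar>(M *\<^sub>v v) $ i\<bar>)"
    using L2_set_le_sum_abs[of "\<lambda>i. (M *\<^sub>v v) $ i" "{..<dim_row M}"]
    by (simp add: l2_norm_vec_def del: index_mult_mat_vec)
  also have "\<dots> \<le> (\<Sum>i<dim_row M. \<Sum>j<dim_col M. \<bar>M $$ (i, j)\<bar>)"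
  proof (rule sum_mono)
    fix i assume "i \<in> {..<dim_row M}"
    then have "\<bar>(M *\<^sub>v v) $ i\<bar> = \<bar>\<Sum>j<dim_col M. M $$ (i, j) * v $ j\<bar>"
      using v by (auto simp: scalar_prod_def atLeast0LessThan intro!: arg_cong[where f = abs] sum.cong)
    also have "\<dots> \<le> (\<Sum>j<dim_col M. \<bar>M $$ (i, j) * v $ j\<bar>)"
      by (rule sum_abs)
    also have "\<dots> \<le> (\<Sum>j<dim_col M. \<bar>M $$ (i, j)\<bar>)"
      using v1 by (intro sum_mono) (simp add: abs_mult mult_left_le)
    finally show "\<bar>(M *\<^sub>v v) $ i\<bar> \<le> (\<Sum>j<dim_col M. \<bar>M $$ (i, j)\<bar>)" .
  qed
  finally show "l2_norm_vec (M *\<^sub>v v) \<le> (\<Sum>i<dim_row M. \<Sum>j<dim_col M. \<bar>M $$ (i, j)\<bar>)" .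
qed

lemma l2_norm_mult_mat_vec_le_spectral_norm:
  assumes "v \<in> carrier_vec (dim_col M)" and "l2_norm_vec v \<le> 1"
  shows "l2_norm_vec (M *\<^sub>v v) \<le> spectral_norm M"
  unfolding spectral_norm_def using assms by (intro cSUP_upper bdd_above_spectral_norm) auto

lemma l2_norm_zero_vec: "l2_norm_vec (0\<^sub>v n) = 0"
  by (simp add: l2_norm_vec_def L2_set_def)

lemma spectral_norm_nonneg: "0 \<le> spectral_norm M"
  using l2_norm_mult_mat_vec_le_spectral_norm[of "0\<^sub>v (dim_col M)" M]
    l2_norm_vec_nonneg[of "M *\<^sub>v 0\<^sub>v (dim_col M)"]
  by (simp add: l2_norm_zero_vec)

lemma spectral_norm_le:
  assumes "\<And>v. v \<in> carrier_vec (dim_col M) \<Longrightarrow> l2_norm_vec v \<le> 1 \<Longrightarrow> l2_norm_vec (M *\<^sub>v v) \<le> c"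
  shows "spectral_norm M \<le> c"
proof -
  \<comment> \<open>The zero vector shows that the supremum is over a nonempty set, as
    \<open>cSUP_least\<close> requires.\<close>
  have "0\<^sub>v (dim_col M) \<in> {v \<in> carrier_vec (dim_col M). l2_norm_vec v \<le> 1}"
    by (simp add: l2_norm_zero_vec)
  then have "{v \<in> carrier_vec (dim_col M). l2_norm_vec v \<le> 1} \<noteq> {}"
    by blast
  then show ?thesis
    unfolding spectral_norm_def using assms by (intro cSUP_least) auto
qed

text \<open>The triangle inequality, with the entrywise bound on absolute values in place of u = v +
  w, so that it covers u = v + w and u = v - w alike.\<close>

lemma l2_norm_vec_le_add:
  assumes "u \<in> carrier_vec n" and "v \<in> carrier_vec n" and "w \<in> carrier_vec n"
    and "\<And>i. i < n \<Longrightarrow> \<bar>u $ i\<bar> \<le> \<bar>v $ i\<bar> + \<bar>w $ i\<bar>"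
  shows "l2_norm_vec u \<le> l2_norm_vec v + l2_norm_vec w"
proof -
  have abs: "l2_norm_vec x = L2_set (\<lambda>i. \<bar>x $ i\<bar>) {..<n}" if "x \<in> carrier_vec n" for x
    using that by (simp add: l2_norm_vec_def L2_set_def)
  have "l2_norm_vec u \<le> L2_set (\<lambda>i. \<bar>v $ i\<bar> + \<bar>w $ i\<bar>) {..<n}"
    unfolding abs[OF assms(1)] using assms(4) by (intro L2_set_mono) auto
  also have "\<dots> \<le> l2_norm_vec v + l2_norm_vec w"
    unfolding abs[OF assms(2)] abs[OF assms(3)] by (rule L2_set_triangle_ineq)
  finally show ?thesis .
qed

lemma abs_spectral_norm_diff_le:
  assumes M: "M \<in> carrier_mat m n" and M': "M' \<in> carrier_mat m n"
  shows "\<bar>spectral_norm M - spectral_norm M'\<bar> \<le> spectral_norm (M - M')"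
proof -
  have le: "spectral_norm P \<le> spectral_norm Q + spectral_norm (M - M')"
    if P: "P \<in> {M, M'}" and Q: "Q \<in> {M, M'}" for P Q
  proof (rule spectral_norm_le)
    fix v assume "v \<in> carrier_vec (dim_col P)" and v1: "l2_norm_vec v \<le> 1"
    then have v: "v \<in> carrier_vec n" using P assms by auto
    have carriers: "P \<in> carrier_mat m n" "Q \<in> carrier_mat m n" "M - M' \<in> carrier_mat m n"
      using P Q M M' by auto
    have "(M - M') *\<^sub>v v = M *\<^sub>v v - M' *\<^sub>v v"
      by (rule minus_mult_distrib_mat_vec[OF M M' v])
    then have "\<bar>(P *\<^sub>v v) $ i\<bar> \<le> \<bar>(Q *\<^sub>v v) $ i\<bar> + \<bar>((M - M') *\<^sub>v v) $ i\<bar>" if "i < m" for i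
      using P Q that M M' by (auto simp del: index_mult_mat_vec)
    then have "l2_norm_vec (P *\<^sub>v v) \<le> l2_norm_vec (Q *\<^sub>v v) + l2_norm_vec ((M - M') *\<^sub>v v)"
      by (rule l2_norm_vec_le_add[OF carriers[THEN mult_mat_vec_carrier, OF v]])
    also have "\<dots> \<le> spectral_norm Q + spectral_norm (M - M')"
      using Q M M' v v1 by (intro add_mono l2_norm_mult_mat_vec_le_spectral_norm) auto
    finally show "l2_norm_vec (P *\<^sub>v v) \<le> spectral_norm Q + spectral_norm (M - M')" .
  qed
  show ?thesis
    using le[of M M'] le[of M' M] by simp
qed

text \<open>A \<open>LEAST\<close> over the reals says something only after a least element is
  exhibited: the maximum of the five norms satisfies all five bounds and lies below every number
  that does.\<close>

lemma system_dist_eq_Max: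
  "system_dist D D' = Max {spectral_norm (sysS D - sysS D'),
     spectral_norm (sysA D - sysA D'), row_sum_norm (sysAbar D - sysAbar D'),
     spectral_norm (sysB D - sysB D'), row_sum_norm (sysBbar D - sysBbar D')}"
  unfolding system_dist_def by (rule Least_equality) auto

lemma norm_diff_le_system_dist:
  "spectral_norm (sysA D - sysA D') \<le> system_dist D D'"
  "row_sum_norm (sysAbar D - sysAbar D') \<le> system_dist D D'"
  "spectral_norm (sysB D - sysB D') \<le> system_dist D D'"
  "row_sum_norm (sysBbar D - sysBbar D') \<le> system_dist D D'"
  unfolding system_dist_eq_Max by (rule Max_ge; simp)+

lemma gnn_size_nonneg: "0 \<le> gnn_size lo hi K L H"
  unfolding gnn_size_def filter_size_def by (intro prod_nonneg) (simp add: row_sum_norm_nonneg)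

lemma abs_mult_diff_le:
  fixes a b a' b' d :: real
  assumes "0 \<le> a" and "0 \<le> b'" and "\<bar>a - a'\<bar> \<le> d" and "\<bar>b - b'\<bar> \<le> d"
  shows "\<bar>a * b - a' * b'\<bar> \<le> (a + b') * d"
proof -
  \<comment> \<open>Inserting a * b' leaves exactly \<open>a\<close> and \<open>b'\<close> as
    coefficients, the two factors assumed nonnegative.\<close>
  have "a * b - a' * b' = a * (b - b') + (a - a') * b'"
    by (simp add: algebra_simps)
  also have "\<bar>\<dots>\<bar> \<le> a * \<bar>b - b'\<bar> + \<bar>a - a'\<bar> * b'"
    using abs_triangle_ineq[of "a * (b - b')" "(a - a') * b'"] assms(1,2) by (simp add: abs_mult)
  also have "\<dots> \<le> a * d + d * b'"
    using assms by (intro add_mono mult_mono) auto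
  finally show ?thesis by (simp add: algebra_simps)
qed

lemma abs_stability_const_diff_le:
  assumes "graph_system N F G E D" and "graph_system N F G E' D'" and "0 \<le> c"
  shows "\<bar>stability_const c D - stability_const c D'\<bar>
    \<le> (spectral_norm (sysA D) + row_sum_norm (sysAbar D')
        + c * (spectral_norm (sysB D) + row_sum_norm (sysBbar D'))) * system_dist D D'"
proof -
  let ?d = "system_dist D D'"
  let ?a = "spectral_norm (sysA D)" and ?a' = "spectral_norm (sysA D')"
  let ?\<alpha> = "row_sum_norm (sysAbar D)" and ?\<alpha>' = "row_sum_norm (sysAbar D')"
  let ?b = "spectral_norm (sysB D)" and ?b' = "spectral_norm (sysB D')"
  let ?\<beta> = "row_sum_norm (sysBbar D)" and ?\<beta>' = "row_sum_norm (sysBbar D')"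
  have D: "sysA D \<in> carrier_mat N N" "sysAbar D \<in> carrier_mat F F"
      "sysB D \<in> carrier_mat N N" "sysBbar D \<in> carrier_mat G F"
    and D': "sysA D' \<in> carrier_mat N N" "sysAbar D' \<in> carrier_mat F F"
      "sysB D' \<in> carrier_mat N N" "sysBbar D' \<in> carrier_mat G F"
    using assms(1,2) by (simp_all add: graph_system_def)
  have d: "\<bar>?a - ?a'\<bar> \<le> ?d" "\<bar>?\<alpha> - ?\<alpha>'\<bar> \<le> ?d" "\<bar>?b - ?b'\<bar> \<le> ?d" "\<bar>?\<beta> - ?\<beta>'\<bar> \<le> ?d"
    by (rule order_trans[OF abs_spectral_norm_diff_le[OF D(1) D'(1)] norm_diff_le_system_dist(1)],
        rule order_trans[OF abs_row_sum_norm_diff_le[OF D(2) D'(2)] norm_diff_le_system_dist(2)],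
        rule order_trans[OF abs_spectral_norm_diff_le[OF D(3) D'(3)] norm_diff_le_system_dist(3)],
        rule order_trans[OF abs_row_sum_norm_diff_le[OF D(4) D'(4)] norm_diff_le_system_dist(4)])
  have A: "\<bar>?a * ?\<alpha> - ?a' * ?\<alpha>'\<bar> \<le> (?a + ?\<alpha>') * ?d"
    by (rule abs_mult_diff_le[OF spectral_norm_nonneg row_sum_norm_nonneg d(1,2)])
  have "\<bar>?b * ?\<beta> - ?b' * ?\<beta>'\<bar> \<le> (?b + ?\<beta>') * ?d"
    by (rule abs_mult_diff_le[OF spectral_norm_nonneg row_sum_norm_nonneg d(3,4)])
  \<comment> \<open>The shared weight \<open>c\<close> is kept outside the difference, so it scales
    the bound instead of contributing a variation of its own.\<close>
  then have "c * \<bar>?b * ?\<beta> - ?b' * ?\<beta>'\<bar> \<le> c * ((?b + ?\<beta>') * ?d)"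
    by (rule mult_left_mono[OF _ assms(3)])
  then have B: "\<bar>c * (?b * ?\<beta> - ?b' * ?\<beta>')\<bar> \<le> c * ((?b + ?\<beta>') * ?d)"
    by (simp add: abs_mult assms(3))
  have "stability_const c D - stability_const c D'
      = (?a * ?\<alpha> - ?a' * ?\<alpha>') + c * (?b * ?\<beta> - ?b' * ?\<beta>')"
    by (simp add: stability_const_def algebra_simps)
  also have "\<bar>\<dots>\<bar> \<le> (?a + ?\<alpha>') * ?d + c * ((?b + ?\<beta>') * ?d)"
    using A B by (intro order_trans[OF abs_triangle_ineq] add_mono)
  also have "\<dots> = (?a + ?\<alpha>' + c * (?b + ?\<beta>')) * ?d"
    by (simp only: distrib_right mult.assoc)
  finally show ?thesis .
qed

theorem proposition2:
  fixes N F G L :: nat and feat K :: "nat \<Rightarrow> nat" and H :: "nat \<Rightarrow> nat \<Rightarrow> real mat"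
    and \<sigma> :: "real \<Rightarrow> real" and lo hi :: real
    and E E' :: "(nat \<times> nat) set" and D D' :: lin_system
    and X U X' U' :: "nat \<Rightarrow> real mat"
  assumes "graph_system N F G E D" and "graph_system N F G E' D'"
    and "feat 0 = F" and "feat L = G" and "gnn_taps feat K L H"
    and "lo \<le> hi"
    and "\<And>a b. \<bar>\<sigma> a - \<sigma> b\<bar> \<le> \<bar>a - b\<bar>" and "\<sigma> 0 = 0"
    and "closed_loop N F G (gnn \<sigma> K H L) D X U"
    and "closed_loop N F G (gnn \<sigma> K H L) D' X' U'"
  shows "\<bar>stability_const (gnn_size lo hi K L H) D - stability_const (gnn_size lo hi K L H) D'\<bar>
    \<le> (spectral_norm (sysA D) + row_sum_norm (sysAbar D')
        + gnn_size lo hi K L H * (spectral_norm (sysB D) + row_sum_norm (sysBbar D'))) * system_dist D D'"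
  by (rule abs_stability_const_diff_le[OF assms(1,2) gnn_size_nonneg])

end
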